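(* Let $n>r\ge 2$ be integers and let $D_n$ be the least common multiple of $1,2,\ldots,n$. Then $$\mathrm{pp}_r(n)=\sum_{(\ell_1,\ldots,\ell_n)\in\mathbf A_n}\ \prod_{s=2}^{n}\ \sum_{\substack{i_s,j_s\ge 0\\ \frac{i_sD_n}{\min\{s,r\}}+j_s=\ell_s}}(-1)^{i_s}\binom{\min\{s,r\}}{i_s}\binom{j_s+\min\{s,r\}-1}{j_s},$$ where $\mathbf A_n=\{(\ell_1,\ldots,\ell_n)\in\mathbb N^n:\ \ell_1+2\ell_2+\cdots+n\ell_n=n\}$ and the innermost sum runs over pairs of nonnegative integers $(i_s,j_s)$ satisfying the displayed equation.
   Context: $\mathbb N=\{0,1,2,\ldots\}$. A plane partition of $n$ is an array $(n_{ij})_{i,j\in\{1,\ldots,n\}}$ of nonnegative integers with $\sum_{i,j}n_{ij}=n$ and $n_{ij}\ge n_{i'j'}$ whenever $i\le i'$ and $j\le j'$; $\mathrm{pp}_r(n)$ denotes the number of plane partitions of $n$ with at most $r$ nonzero rows (i.e. $n_{ij}=0$ for all $i>r$). *)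

theory Defs
  imports Complex_Main "HOL-Library.FuncSet"
begin

text \<open>Tuples and arrays are functions on their index sets, extensional in the sense of
  \<^const>\<open>PiE\<close> so that cardinalities and sums see each of them exactly once.\<close>

definition plane_partitions :: "nat \<Rightarrow> (nat \<times> nat \<Rightarrow> nat) set" where
  "plane_partitions n =
    {a \<in> {1..n} \<times> {1..n} \<rightarrow>\<^sub>E UNIV.
       (\<Sum>p\<in>{1..n} \<times> {1..n}. a p) = n \<and>
       (\<forall>i\<in>{1..n}. \<forall>j\<in>{1..n}. \<forall>i'\<in>{1..n}. \<forall>j'\<in>{1..n}.
          i \<le> i' \<longrightarrow> j \<le> j' \<longrightarrow> a (i, j) \<ge> a (i', j'))}"

definition pp :: "nat \<Rightarrow> nat \<Rightarrow> nat" where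
  "pp r n = card {a \<in> plane_partitions n. \<forall>i\<in>{1..n}. \<forall>j\<in>{1..n}. i > r \<longrightarrow> a (i, j) = 0}"

definition D :: "nat \<Rightarrow> nat" where
  "D n = Lcm {1..n}"

definition A :: "nat \<Rightarrow> (nat \<Rightarrow> nat) set" where
  "A n = {l \<in> {1..n} \<rightarrow>\<^sub>E UNIV. (\<Sum>s\<in>{1..n}. s * l s) = n}"

text \<open>The equation between the indices is read over the rationals, so \<open>/\<close> is true division.\<close>

definition index_pairs :: "nat \<Rightarrow> nat \<Rightarrow> nat \<Rightarrow> (nat \<times> nat) set" where
  "index_pairs d m l = {(i, j). of_nat (i * d) / of_nat m + of_nat j = (of_nat l :: rat)}"

end

theory Submission
  imports Defs "HOL-Analysis.Binary_Product_Measure" "HOL-Computational_Algebra.Formal_Power_Series"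
begin

text \<open>The diagonals of a plane partition with \<open>r\<close> rows form a sequence of interlacing partitions that
  increases up to the main diagonal and decreases after it. A local move exchanges an up-step followed
  by a down-step with a down-step followed by an up-step, at the cost of one free nonnegative integer
  (the commutation relation of vertex operators). Moving all down-steps to the front leaves only the
  empty sequence, and so the generating function is MacMahon's product of the \<open>1 / (1 - q\<^sup>s)\<close> with
  multiplicity \<open>min s r\<close>; its coefficients are sums of products of binomial coefficients. Finally,
  since \<open>D n > n\<close> for \<open>n \<ge> 3\<close>, only the terms with \<open>i = 0\<close> occur in the inner sums.\<close>

unbundle no vec_syntax
unbundle fps_syntax

subsection \<open>Infinite sums of formal power series\<close>

text \<open>Coefficients in \<^typ>\<open>ennreal\<close> make every coefficientwise sum meaningful and interchangeable.\<close>

definition fps_Sum :: "'a set \<Rightarrow> ('a \<Rightarrow> ennreal fps) \<Rightarrow> ennreal fps" where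
  "fps_Sum S f = Abs_fps (\<lambda>n. \<integral>\<^sup>+x. f x $ n \<partial>count_space S)"

lemma fps_Sum_nth: "fps_Sum S f $ n = (\<integral>\<^sup>+x. f x $ n \<partial>count_space S)"
  by (simp add: fps_Sum_def)

lemma fps_Sum_cong: "S = T \<Longrightarrow> (\<And>x. x \<in> T \<Longrightarrow> f x = g x) \<Longrightarrow> fps_Sum S f = fps_Sum T g"
  by (auto simp: fps_eq_iff fps_Sum_nth intro!: nn_integral_cong)

lemma fps_Sum_mult_left: "c * fps_Sum S f = fps_Sum S (\<lambda>x. c * f x)"
  by (simp add: fps_eq_iff fps_Sum_nth fps_mult_nth nn_integral_sum nn_integral_cmult)

lemma fps_Sum_mult_right: "fps_Sum S f * c = fps_Sum S (\<lambda>x. f x * c)"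
  using fps_Sum_mult_left[of c S f] by (simp add: mult.commute)

lemma fps_Sum_singleton [simp]: "fps_Sum {x} f = f x"
  by (simp add: fps_eq_iff fps_Sum_nth nn_integral_count_space_finite)

lemma fps_Sum_empty [simp]: "fps_Sum {} f = 0"
  by (simp add: fps_eq_iff fps_Sum_nth nn_integral_count_space_finite)

lemma fps_Sum_bij: "bij_betw g S T \<Longrightarrow> fps_Sum S (\<lambda>x. f (g x)) = fps_Sum T f"
  using nn_integral_bij_count_space[of g S T "\<lambda>x. f x $ n" for n]
  by (simp add: fps_eq_iff fps_Sum_nth)

lemma fps_Sum_reindex:
  assumes "\<And>x. x \<in> S \<Longrightarrow> h (g x) = x" "\<And>x. x \<in> S \<Longrightarrow> g x \<in> T"
    and "\<And>y. y \<in> T \<Longrightarrow> g (h y) = y" "\<And>y. y \<in> T \<Longrightarrow> h y \<in> S"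
    and "\<And>x. x \<in> S \<Longrightarrow> f' x = f (g x)"
  shows "fps_Sum S f' = fps_Sum T f"
proof -
  have "bij_betw g S T"
    using assms by (intro bij_betw_byWitness[of _ h]) auto
  from fps_Sum_bij[OF this] show ?thesis
    using fps_Sum_cong[of S S f' "\<lambda>x. f (g x)"] assms by simp
qed

lemma fps_Sum_mono_neutral:
  assumes "S \<subseteq> T" "\<And>x. x \<in> T - S \<Longrightarrow> f x = 0"
  shows "fps_Sum S f = fps_Sum T f"
  using assms
  by (auto simp: fps_eq_iff fps_Sum_nth intro!: nn_integral_count_space_eq)

text \<open>Tonelli for counting measures. The integrands are extended by zero to whole types, where
  \<open>nn_integral_fst_count_space\<close> applies.\<close>

lemma fps_Sum_Sigma: "fps_Sum S (\<lambda>x. fps_Sum (T x) (f x)) = fps_Sum (Sigma S T) (\<lambda>(x, y). f x y)"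
proof -
  have restr: "(\<integral>\<^sup>+x. h x \<partial>count_space U) = (\<integral>\<^sup>+x. (if x \<in> U then h x else 0) \<partial>count_space UNIV)"
    for U :: "'z set" and h
    using nn_integral_count_space_eq[of U UNIV "\<lambda>x. if x \<in> U then h x else 0"]
    by (simp cong: nn_integral_cong_simp)
  have "(\<integral>\<^sup>+x. \<integral>\<^sup>+y. f x y $ n \<partial>count_space (T x) \<partial>count_space S)
      = (\<integral>\<^sup>+p. (case p of (x, y) \<Rightarrow> f x y) $ n \<partial>count_space (Sigma S T))" for n
  proof -
    let ?h = "\<lambda>(x, y). if x \<in> S \<and> y \<in> T x then f x y $ n else 0"
    have "(\<integral>\<^sup>+x. \<integral>\<^sup>+y. f x y $ n \<partial>count_space (T x) \<partial>count_space S)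
        = (\<integral>\<^sup>+x. \<integral>\<^sup>+y. ?h (x, y) \<partial>count_space UNIV \<partial>count_space UNIV)"
      by (subst restr, subst restr) (auto intro!: nn_integral_cong)
    also have "\<dots> = (\<integral>\<^sup>+p. ?h p \<partial>count_space UNIV)"
      by (rule nn_integral_fst_count_space)
    also have "\<dots> = (\<integral>\<^sup>+p. (case p of (x, y) \<Rightarrow> f x y) $ n \<partial>count_space (Sigma S T))"
      by (subst (2) restr) (auto intro!: nn_integral_cong)
    finally show ?thesis .
  qed
  then show ?thesis
    by (simp add: fps_eq_iff fps_Sum_nth)
qed

text \<open>Turns a coefficient into a count. An infinite fibre has measure infinity, so finiteness
  of a fibre can be read off from the coefficient afterwards.\<close>

lemma fps_Sum_X_power_nth:
  "fps_Sum S (\<lambda>x. fps_X ^ w x) $ n = emeasure (count_space S) {x \<in> S. w x = n}"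
proof -
  have "fps_Sum S (\<lambda>x. fps_X ^ w x) $ n = (\<integral>\<^sup>+x. indicator {x \<in> S. w x = n} x \<partial>count_space S)"
    unfolding fps_Sum_nth
    by (intro nn_integral_cong) (auto simp: fps_X_power_iff split: split_indicator)
  then show ?thesis by simp
qed

subsection \<open>Interlacing partitions\<close>

text \<open>Says that \<rho>/\<mu> is a horizontal strip. The chain
  \<open>\<rho> 0 \<ge> \<mu> 0 \<ge> \<rho> 1 \<ge> ...\<close> makes both functions weakly
  decreasing, so partitions can be plain functions.\<close>

definition interlace :: "(nat \<Rightarrow> nat) \<Rightarrow> (nat \<Rightarrow> nat) \<Rightarrow> bool" where
  "interlace \<mu> \<rho> \<longleftrightarrow> (\<forall>k. \<mu> k \<le> \<rho> k \<and> \<rho> (Suc k) \<le> \<mu> k)"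

definition fin_supp :: "(nat \<Rightarrow> nat) \<Rightarrow> bool" where
  "fin_supp \<rho> \<longleftrightarrow> finite {k. \<rho> k \<noteq> 0}"

text \<open>An infinite support yields the default value 0. This is harmless because
  \<open>tails_gf_fin_supp\<close> gives such functions weight zero.\<close>

definition size_of :: "(nat \<Rightarrow> nat) \<Rightarrow> nat" where
  "size_of \<rho> = (\<Sum>k | \<rho> k \<noteq> 0. \<rho> k)"

lemma size_of_eq: "(\<And>k. k \<ge> N \<Longrightarrow> \<rho> k = 0) \<Longrightarrow> size_of \<rho> = (\<Sum>k<N. \<rho> k)"
  unfolding size_of_def by (rule sum.mono_neutral_left) (auto intro: leI ccontr)

lemma fin_supp_iff: "fin_supp \<rho> \<longleftrightarrow> (\<exists>N. \<forall>k\<ge>N. \<rho> k = 0)"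
proof
  assume "fin_supp \<rho>"
  then obtain N where "\<forall>k\<in>{k. \<rho> k \<noteq> 0}. k < N"
    unfolding fin_supp_def finite_nat_set_iff_bounded by auto
  then show "\<exists>N. \<forall>k\<ge>N. \<rho> k = 0" by (meson mem_Collect_eq not_less)
next
  assume "\<exists>N. \<forall>k\<ge>N. \<rho> k = 0"
  then show "fin_supp \<rho>"
    unfolding fin_supp_def finite_nat_set_iff_bounded by (metis mem_Collect_eq not_le)
qed

lemma interlace_fin_supp: "interlace \<mu> \<rho> \<Longrightarrow> fin_supp \<mu> \<longleftrightarrow> fin_supp \<rho>"
  unfolding fin_supp_iff interlace_def
proof safe
  fix N assume *: "\<forall>k. \<mu> k \<le> \<rho> k \<and> \<rho> (Suc k) \<le> \<mu> k" and N: "\<forall>k\<ge>N. \<mu> k = 0"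
  have "\<rho> k = 0" if "k \<ge> Suc N" for k
    using that *[rule_format, of "k - 1"] N by (cases k) auto
  then show "\<exists>N. \<forall>k\<ge>N. \<rho> k = 0" by blast
next
  fix N assume *: "\<forall>k. \<mu> k \<le> \<rho> k \<and> \<rho> (Suc k) \<le> \<mu> k" and N: "\<forall>k\<ge>N. \<rho> k = 0"
  have "\<mu> k = 0" if "k \<ge> N" for k
    using that *[rule_format, of k] N by auto
  then show "\<exists>N. \<forall>k\<ge>N. \<mu> k = 0" by blast
qed

lemma interlace_size_le:
  assumes "interlace \<mu> \<rho>" "fin_supp \<rho>"
  shows "size_of \<mu> \<le> size_of \<rho>"
proof -
  obtain N where N: "\<And>k. k \<ge> N \<Longrightarrow> \<rho> k = 0"
    using assms by (auto simp: fin_supp_iff)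
  have "\<mu> k \<le> \<rho> k" for k
    using assms by (simp add: interlace_def)
  moreover from this have "\<mu> k = 0" if "k \<ge> N" for k
    using N[OF that] by (metis le_zero_eq)
  ultimately show ?thesis
    using N by (simp add: size_of_eq[of N] sum_mono)
qed

text \<open>For partitions \<open>\<rho>\<close> above both \<open>\<mu>\<close> and \<open>\<nu>\<close>, the part \<open>\<rho> (Suc k)\<close> ranges over the interval
  from \<open>max (\<mu> (Suc k)) (\<nu> (Suc k))\<close> to \<open>min (\<mu> k) (\<nu> k)\<close>, which is also the range of \<open>\<kappa> k\<close> for \<open>\<kappa>\<close> below
  both. The bijection reflects each of these intervals; the excess of \<open>\<rho> 0\<close> is recorded separately.\<close>

definition toggle :: "(nat \<Rightarrow> nat) \<Rightarrow> (nat \<Rightarrow> nat) \<Rightarrow> (nat \<Rightarrow> nat) \<Rightarrow> nat \<Rightarrow> nat" where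
  "toggle \<mu> \<nu> \<rho> k = min (\<mu> k) (\<nu> k) + max (\<mu> (Suc k)) (\<nu> (Suc k)) - \<rho> (Suc k)"

definition untoggle :: "(nat \<Rightarrow> nat) \<Rightarrow> (nat \<Rightarrow> nat) \<Rightarrow> (nat \<Rightarrow> nat) \<Rightarrow> nat \<Rightarrow> nat \<Rightarrow> nat" where
  "untoggle \<mu> \<nu> \<kappa> a k = (case k of 0 \<Rightarrow> a + max (\<mu> 0) (\<nu> 0)
     | Suc k \<Rightarrow> min (\<mu> k) (\<nu> k) + max (\<mu> (Suc k)) (\<nu> (Suc k)) - \<kappa> k)"

lemma interlace_both_upper_iff:
  "interlace \<mu> \<rho> \<and> interlace \<nu> \<rho> \<longleftrightarrow>
     max (\<mu> 0) (\<nu> 0) \<le> \<rho> 0 \<and>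
     (\<forall>k. max (\<mu> (Suc k)) (\<nu> (Suc k)) \<le> \<rho> (Suc k) \<and> \<rho> (Suc k) \<le> min (\<mu> k) (\<nu> k))"
proof -
  have "(\<forall>k. P k) \<longleftrightarrow> P 0 \<and> (\<forall>k. P (Suc k))" for P :: "nat \<Rightarrow> bool"
    by (metis nat.exhaust)
  from this[of "\<lambda>k. \<mu> k \<le> \<rho> k"] this[of "\<lambda>k. \<nu> k \<le> \<rho> k"]
  show ?thesis unfolding interlace_def by auto
qed

lemma interlace_both_lower_iff:
  "interlace \<kappa> \<mu> \<and> interlace \<kappa> \<nu> \<longleftrightarrow>
     (\<forall>k. max (\<mu> (Suc k)) (\<nu> (Suc k)) \<le> \<kappa> k \<and> \<kappa> k \<le> min (\<mu> k) (\<nu> k))"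
  unfolding interlace_def by auto

text \<open>The reflection \<open>x \<mapsto> lo + hi - x\<close> maps the interval from
  \<open>lo\<close> to \<open>hi\<close> onto itself and is an involution there; lying in the
  interval also keeps the truncated subtraction exact. Only \<open>\<rho> 0\<close> is lost, and its
  excess restores it.\<close>

lemma toggle_interlace:
  assumes "interlace \<mu> \<rho>" "interlace \<nu> \<rho>"
  shows "interlace (toggle \<mu> \<nu> \<rho>) \<mu>" "interlace (toggle \<mu> \<nu> \<rho>) \<nu>"
    and "untoggle \<mu> \<nu> (toggle \<mu> \<nu> \<rho>) (\<rho> 0 - max (\<mu> 0) (\<nu> 0)) = \<rho>"
proof -
  note * = interlace_both_upper_iff[THEN iffD1, OF conjI[OF assms]]
  have "interlace (toggle \<mu> \<nu> \<rho>) \<mu> \<and> interlace (toggle \<mu> \<nu> \<rho>) \<nu>"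
    unfolding interlace_both_lower_iff
  proof
    fix k
    show "max (\<mu> (Suc k)) (\<nu> (Suc k)) \<le> toggle \<mu> \<nu> \<rho> k \<and> toggle \<mu> \<nu> \<rho> k \<le> min (\<mu> k) (\<nu> k)"
      using *[THEN conjunct2, rule_format, of k] unfolding toggle_def by linarith
  qed
  then show "interlace (toggle \<mu> \<nu> \<rho>) \<mu>" "interlace (toggle \<mu> \<nu> \<rho>) \<nu>" by auto
  show "untoggle \<mu> \<nu> (toggle \<mu> \<nu> \<rho>) (\<rho> 0 - max (\<mu> 0) (\<nu> 0)) = \<rho>"
  proof
    fix k
    show "untoggle \<mu> \<nu> (toggle \<mu> \<nu> \<rho>) (\<rho> 0 - max (\<mu> 0) (\<nu> 0)) k = \<rho> k"
    proof (cases k)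
      case 0
      then show ?thesis using * by (simp add: untoggle_def)
    next
      case (Suc k')
      then show ?thesis using *[THEN conjunct2, rule_format, of k']
        unfolding untoggle_def toggle_def Suc nat.case by linarith
    qed
  qed
qed

lemma untoggle_interlace:
  assumes "interlace \<kappa> \<mu>" "interlace \<kappa> \<nu>"
  shows "interlace \<mu> (untoggle \<mu> \<nu> \<kappa> a)" "interlace \<nu> (untoggle \<mu> \<nu> \<kappa> a)"
    and "toggle \<mu> \<nu> (untoggle \<mu> \<nu> \<kappa> a) = \<kappa>"
    and "untoggle \<mu> \<nu> \<kappa> a 0 - max (\<mu> 0) (\<nu> 0) = a"
proof -
  note * = interlace_both_lower_iff[THEN iffD1, OF conjI[OF assms], rule_format]
  have "interlace \<mu> (untoggle \<mu> \<nu> \<kappa> a) \<and> interlace \<nu> (untoggle \<mu> \<nu> \<kappa> a)"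
    unfolding interlace_both_upper_iff
  proof (intro conjI allI)
    fix k
    show "max (\<mu> (Suc k)) (\<nu> (Suc k)) \<le> untoggle \<mu> \<nu> \<kappa> a (Suc k)"
      "untoggle \<mu> \<nu> \<kappa> a (Suc k) \<le> min (\<mu> k) (\<nu> k)"
      using *[of k] unfolding untoggle_def nat.case by linarith+
  qed (simp add: untoggle_def)
  then show "interlace \<mu> (untoggle \<mu> \<nu> \<kappa> a)" "interlace \<nu> (untoggle \<mu> \<nu> \<kappa> a)" by auto
  show "toggle \<mu> \<nu> (untoggle \<mu> \<nu> \<kappa> a) = \<kappa>"
  proof
    fix k
    show "toggle \<mu> \<nu> (untoggle \<mu> \<nu> \<kappa> a) k = \<kappa> k"
      using *[of k] unfolding untoggle_def toggle_def nat.case by linarith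
  qed
  show "untoggle \<mu> \<nu> \<kappa> a 0 - max (\<mu> 0) (\<nu> 0) = a"
    by (simp add: untoggle_def)
qed

text \<open>A value and its reflection add up to the sum of the interval's endpoints, so the total
  consists of all minima and all maxima of \<mu> and \<nu>, plus the excess.\<close>

lemma size_of_untoggle:
  assumes "interlace \<kappa> \<mu>" "interlace \<kappa> \<nu>" "fin_supp \<nu>"
  shows "size_of (untoggle \<mu> \<nu> \<kappa> a) + size_of \<kappa> = size_of \<mu> + size_of \<nu> + a"
proof -
  let ?\<rho> = "untoggle \<mu> \<nu> \<kappa> a"
  note * = interlace_both_lower_iff[THEN iffD1, OF conjI[OF assms(1,2)], rule_format]
  have "fin_supp \<mu>" using assms interlace_fin_supp by blast
  then obtain N1 N2 where N12: "\<forall>k\<ge>N1. \<mu> k = 0" "\<forall>k\<ge>N2. \<nu> k = 0"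
    using assms(3) unfolding fin_supp_iff by blast
  define N where "N = max N1 N2"
  have \<mu>: "\<mu> k = 0" and \<nu>: "\<nu> k = 0" and \<kappa>: "\<kappa> k = 0" if "k \<ge> N" for k
    using that N12 *[of k] by (auto simp: N_def)
  have \<rho>: "?\<rho> k = 0" if "k \<ge> Suc N" for k
    using that \<mu> \<nu> by (cases k) (auto simp: untoggle_def)
  \<comment> \<open>\<open>untoggle\<close> shifts indices by one, hence the bound
    \<open>Suc N\<close> for its support. Splitting off \<open>?\<rho> 0\<close> pairs each later
    part with its mirror image in \<kappa>.\<close>
  have "size_of ?\<rho> + size_of \<kappa> = ?\<rho> 0 + (\<Sum>k<N. ?\<rho> (Suc k) + \<kappa> k)"
    using size_of_eq[of "Suc N" ?\<rho>, OF \<rho>] size_of_eq[of N \<kappa>, OF \<kappa>]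
    by (simp add: sum.lessThan_Suc_shift sum.distrib del: sum.lessThan_Suc)
  also have "(\<Sum>k<N. ?\<rho> (Suc k) + \<kappa> k) = (\<Sum>k<N. min (\<mu> k) (\<nu> k) + max (\<mu> (Suc k)) (\<nu> (Suc k)))"
  proof (rule sum.cong)
    fix k
    show "?\<rho> (Suc k) + \<kappa> k = min (\<mu> k) (\<nu> k) + max (\<mu> (Suc k)) (\<nu> (Suc k))"
      using *[of k] unfolding untoggle_def nat.case by linarith
  qed simp
  also have "?\<rho> 0 + \<dots> = a + (\<Sum>k<N. min (\<mu> k) (\<nu> k)) + (\<Sum>k<Suc N. max (\<mu> k) (\<nu> k))"
    by (simp add: untoggle_def sum.lessThan_Suc_shift sum.distrib del: sum.lessThan_Suc)
  \<comment> \<open>The maximum at index \<open>N\<close> is zero and drops out.\<close>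
  also have "\<dots> = a + (\<Sum>k<N. min (\<mu> k) (\<nu> k) + max (\<mu> k) (\<nu> k))"
    using \<mu> \<nu> by (simp add: sum.distrib)
  also have "(\<Sum>k<N. min (\<mu> k) (\<nu> k) + max (\<mu> k) (\<nu> k)) = (\<Sum>k<N. \<mu> k + \<nu> k)"
    by (rule sum.cong) auto
  also have "\<dots> = size_of \<mu> + size_of \<nu>"
    using \<mu> \<nu> by (simp add: size_of_eq[of N] sum.distrib)
  finally show ?thesis by simp
qed

section \<open>Commuting up-steps past down-steps, and the resulting Cauchy-type product\<close>

definition geo :: "ennreal fps \<Rightarrow> ennreal fps" where
  "geo t = fps_Sum UNIV (\<lambda>a. t ^ a)"

text \<open>Generating function, by total size excluding \<open>\<rho>\<close> itself, of the decreasing interlacing sequences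
  starting at \<open>\<rho>\<close> that vanish after \<open>c\<close> steps.\<close>

fun tails_gf :: "nat \<Rightarrow> (nat \<Rightarrow> nat) \<Rightarrow> ennreal fps" where
  "tails_gf 0 \<rho> = (if \<rho> = (\<lambda>_. 0) then 1 else 0)"
| "tails_gf (Suc c) \<rho> = fps_Sum {\<nu>. interlace \<nu> \<rho>} (\<lambda>\<nu>. fps_X ^ size_of \<nu> * tails_gf c \<nu>)"

lemma interlace_zero_iff: "interlace \<nu> (\<lambda>_. 0) \<longleftrightarrow> \<nu> = (\<lambda>_. 0)"
  by (auto simp: interlace_def)

lemma size_of_zero [simp]: "size_of (\<lambda>_. 0) = 0"
  by (simp add: size_of_def)

lemma fin_supp_zero [simp]: "fin_supp (\<lambda>_. 0)"
  by (simp add: fin_supp_def)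

text \<open>One up-step is moved through \<open>r\<close> down-steps; each exchange releases a free
  excess, summed by a geometric series. The variable \<open>y\<close> marks the growth of the
  up-step and turns into \<open>X * y\<close> with each exchange, so it must stay arbitrary in the
  induction.\<close>

lemma push_tails_gf:
  assumes "fin_supp \<nu>"
  shows "fps_Sum {\<rho>. interlace \<nu> \<rho>} (\<lambda>\<rho>. y ^ (size_of \<rho> - size_of \<nu>) * (fps_X ^ size_of \<rho> * tails_gf r \<rho>))
    = (\<Prod>i<r. geo (fps_X ^ Suc i * y)) * (fps_X ^ size_of \<nu> * tails_gf r \<nu>)"
  using assms
proof (induction r arbitrary: y \<nu>)
  case 0
  show ?case
  proof (cases "\<nu> = (\<lambda>_. 0)")
    case True
    have "fps_Sum {\<rho>. interlace \<nu> \<rho>} (\<lambda>\<rho>. y ^ (size_of \<rho> - size_of \<nu>) * (fps_X ^ size_of \<rho> * tails_gf 0 \<rho>))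
      = fps_Sum {\<lambda>_. 0} (\<lambda>\<rho>. y ^ (size_of \<rho> - size_of \<nu>) * (fps_X ^ size_of \<rho> * tails_gf 0 \<rho>))"
      using True by (intro fps_Sum_mono_neutral[symmetric]) (auto simp: interlace_zero_iff)
    then show ?thesis using True by simp
  next
    case False
    have "fps_Sum {} (\<lambda>\<rho>. y ^ (size_of \<rho> - size_of \<nu>) * (fps_X ^ size_of \<rho> * tails_gf 0 \<rho>))
      = fps_Sum {\<rho>. interlace \<nu> \<rho>} (\<lambda>\<rho>. y ^ (size_of \<rho> - size_of \<nu>) * (fps_X ^ size_of \<rho> * tails_gf 0 \<rho>))"
      using False by (intro fps_Sum_mono_neutral) (auto simp: interlace_zero_iff)
    then show ?thesis using False by simp
  qed
next
  case (Suc r)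
  let ?X = "fps_X :: ennreal fps"
  \<comment> \<open>\<open>?S\<close> holds the paths from \<nu> up to \<rho> and down to \<mu>,
    \<open>?T\<close> the paths from \<nu> down to \<kappa> and up to \<mu> together with a free
    excess \<open>a\<close>.\<close>
  let ?S = "SIGMA \<rho>:{\<rho>. interlace \<nu> \<rho>}. {\<mu>. interlace \<mu> \<rho>}"
  let ?T = "SIGMA \<kappa>:{\<kappa>. interlace \<kappa> \<nu>}. SIGMA \<mu>:{\<mu>. interlace \<kappa> \<mu>}. (UNIV :: nat set)"
  let ?g = "\<lambda>(\<rho>, \<mu>). (toggle \<mu> \<nu> \<rho>, \<mu>, \<rho> 0 - max (\<mu> 0) (\<nu> 0))"
  let ?h = "\<lambda>(\<kappa>, \<mu>, a). (untoggle \<mu> \<nu> \<kappa> a, \<mu>)"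
  let ?w = "\<lambda>(\<rho>, \<mu>). y ^ (size_of \<rho> - size_of \<nu>) * (?X ^ size_of \<rho> * (?X ^ size_of \<mu> * tails_gf r \<mu>))"
  let ?v = "\<lambda>\<kappa> \<mu> a. ?X ^ size_of \<nu> * (?X * y) ^ a *
              ((?X * y) ^ (size_of \<mu> - size_of \<kappa>) * (?X ^ size_of \<mu> * tails_gf r \<mu>))"
  have weight: "?w (?h (\<kappa>, \<mu>, a)) = ?v \<kappa> \<mu> a" if "interlace \<kappa> \<nu>" "interlace \<kappa> \<mu>" for \<kappa> \<mu> a
  proof -
    let ?\<rho> = "untoggle \<mu> \<nu> \<kappa> a"
    have s: "size_of ?\<rho> + size_of \<kappa> = size_of \<mu> + size_of \<nu> + a"
      using size_of_untoggle[OF that(2,1) \<open>fin_supp \<nu>\<close>] .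
    have "fin_supp \<mu>" using that \<open>fin_supp \<nu>\<close> interlace_fin_supp by blast
    then have le: "size_of \<kappa> \<le> size_of \<mu>" using that interlace_size_le by blast
    \<comment> \<open>The growth of the old up-step is that of the new one plus \<open>a\<close>. As
      \<open>X\<close> is raised to the size of \<rho> too, both parts of this growth are marked by
      \<open>X * y\<close>.\<close>
    have "size_of ?\<rho> - size_of \<nu> = size_of \<mu> - size_of \<kappa> + a"
      "size_of ?\<rho> = size_of \<nu> + a + (size_of \<mu> - size_of \<kappa>)"
      using s le by linarith+
    then show ?thesis
      by (simp add: power_add power_mult_distrib mult_ac)
  qed
  have "fps_Sum {\<rho>. interlace \<nu> \<rho>} (\<lambda>\<rho>. y ^ (size_of \<rho> - size_of \<nu>) * (?X ^ size_of \<rho> * tails_gf (Suc r) \<rho>))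
      = fps_Sum {\<rho>. interlace \<nu> \<rho>} (\<lambda>\<rho>. fps_Sum {\<mu>. interlace \<mu> \<rho>} (\<lambda>\<mu>. ?w (\<rho>, \<mu>)))"
    by (simp add: fps_Sum_mult_left)
  also have "\<dots> = fps_Sum ?S ?w"
    unfolding fps_Sum_Sigma by (simp add: case_prod_unfold)
  also have "\<dots> = fps_Sum ?T (\<lambda>(\<kappa>, \<mu>, a). ?v \<kappa> \<mu> a)"
  proof (rule fps_Sum_reindex[symmetric, where g = ?h and h = ?g])
    fix p assume "p \<in> ?T"
    then show "?g (?h p) = p" "?h p \<in> ?S" by (auto simp: untoggle_interlace)
    show "(case p of (\<kappa>, \<mu>, a) \<Rightarrow> ?v \<kappa> \<mu> a) = ?w (?h p)"
      using \<open>p \<in> ?T\<close> weight by (auto simp del: power_mult_distrib)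
  next
    fix p assume "p \<in> ?S"
    then show "?h (?g p) = p" "?g p \<in> ?T" by (auto simp: toggle_interlace)
  qed
  also have "\<dots> = fps_Sum {\<kappa>. interlace \<kappa> \<nu>} (\<lambda>\<kappa>. fps_Sum {\<mu>. interlace \<kappa> \<mu>} (\<lambda>\<mu>. fps_Sum UNIV (\<lambda>a. ?v \<kappa> \<mu> a)))"
    unfolding fps_Sum_Sigma by (simp add: case_prod_unfold)
  also have "\<dots> = fps_Sum {\<kappa>. interlace \<kappa> \<nu>} (\<lambda>\<kappa>. ?X ^ size_of \<nu> * geo (?X * y) *
      fps_Sum {\<mu>. interlace \<kappa> \<mu>} (\<lambda>\<mu>. (?X * y) ^ (size_of \<mu> - size_of \<kappa>) * (?X ^ size_of \<mu> * tails_gf r \<mu>)))"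
    by (simp add: geo_def fps_Sum_mult_left fps_Sum_mult_right)
  \<comment> \<open>The induction hypothesis is applied at \<open>?X * y\<close> to the shorter
    tail; \<open>geo (?X * y)\<close> later becomes the factor with index 0.\<close>
  also have "\<dots> = fps_Sum {\<kappa>. interlace \<kappa> \<nu>} (\<lambda>\<kappa>. ?X ^ size_of \<nu> * geo (?X * y) *
      ((\<Prod>i<r. geo (?X ^ Suc i * (?X * y))) * (?X ^ size_of \<kappa> * tails_gf r \<kappa>)))"
  proof (intro fps_Sum_cong refl)
    fix \<kappa> assume "\<kappa> \<in> {\<kappa>. interlace \<kappa> \<nu>}"
    then have "fin_supp \<kappa>" using Suc.prems interlace_fin_supp by blast
    from Suc.IH[OF this] show "?X ^ size_of \<nu> * geo (?X * y) *
      fps_Sum {\<mu>. interlace \<kappa> \<mu>} (\<lambda>\<mu>. (?X * y) ^ (size_of \<mu> - size_of \<kappa>) * (?X ^ size_of \<mu> * tails_gf r \<mu>))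
      = ?X ^ size_of \<nu> * geo (?X * y) *
      ((\<Prod>i<r. geo (?X ^ Suc i * (?X * y))) * (?X ^ size_of \<kappa> * tails_gf r \<kappa>))"
      by simp
  qed
  also have "\<dots> = (geo (?X * y) * (\<Prod>i<r. geo (?X ^ Suc i * (?X * y)))) * (?X ^ size_of \<nu> * tails_gf (Suc r) \<nu>)"
    by (simp add: fps_Sum_mult_left mult_ac)
  also have "geo (?X * y) * (\<Prod>i<r. geo (?X ^ Suc i * (?X * y))) = (\<Prod>i<Suc r. geo (?X ^ Suc i * y))"
    by (subst prod.lessThan_Suc_shift) (simp add: mult_ac)
  finally show ?case .
qed

text \<open>Interlacing preserves finiteness of the support, and every tail ends in the zero
  partition. Sums may therefore range over all functions.\<close>

lemma tails_gf_fin_supp: "\<not> fin_supp \<rho> \<Longrightarrow> tails_gf c \<rho> = 0"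
proof (induction c arbitrary: \<rho>)
  case (Suc c)
  have "tails_gf (Suc c) \<rho> = fps_Sum {\<nu>. interlace \<nu> \<rho>} (\<lambda>\<nu>. 0)"
    unfolding tails_gf.simps using Suc interlace_fin_supp by (intro fps_Sum_cong) auto
  then show ?case
    by (simp add: fps_eq_iff fps_Sum_nth)
qed auto

text \<open>Induction on the second tail: its first down-step, read backwards, is an up-step, which
  \<open>push_tails_gf\<close> moves through the first tail at the cost of one inner product. The
  variable \<open>y\<close> marks the central partition and becomes \<open>X * y\<close> for the
  next round.\<close>

lemma cauchy_tails_gf:
  "fps_Sum UNIV (\<lambda>\<rho>. y ^ size_of \<rho> * (fps_X ^ size_of \<rho> * tails_gf r \<rho>) * tails_gf c \<rho>)
    = (\<Prod>j<c. \<Prod>i<r. geo (fps_X ^ Suc (i + j) * y))"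
proof (induction c arbitrary: y)
  case 0
  have "fps_Sum {\<lambda>_. 0} (\<lambda>\<rho>. y ^ size_of \<rho> * (fps_X ^ size_of \<rho> * tails_gf r \<rho>) * tails_gf 0 \<rho>)
     = fps_Sum UNIV (\<lambda>\<rho>. y ^ size_of \<rho> * (fps_X ^ size_of \<rho> * tails_gf r \<rho>) * tails_gf 0 \<rho>)"
    by (intro fps_Sum_mono_neutral) auto
  moreover have "tails_gf r (\<lambda>_. 0) = 1"
    by (induction r) (auto simp: interlace_zero_iff)
  ultimately show ?case by simp
next
  case (Suc c)
  let ?X = "fps_X :: ennreal fps"
  let ?w = "\<lambda>\<rho> \<nu>. (?X * y) ^ size_of \<nu> * tails_gf c \<nu> *
     (y ^ (size_of \<rho> - size_of \<nu>) * (?X ^ size_of \<rho> * tails_gf r \<rho>))"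
  have w: "y ^ size_of \<rho> * (?X ^ size_of \<rho> * tails_gf r \<rho>) * (?X ^ size_of \<nu> * tails_gf c \<nu>) = ?w \<rho> \<nu>"
    if "interlace \<nu> \<rho>" for \<rho> \<nu>
  \<comment> \<open>With infinite support the truncated difference of sizes is unreliable, but then
    both sides vanish through \<open>tails_gf r \<rho>\<close>.\<close>
  proof (cases "fin_supp \<rho>")
    case True
    then have "size_of \<rho> = size_of \<nu> + (size_of \<rho> - size_of \<nu>)"
      using interlace_size_le[OF that] by simp
    then have "y ^ size_of \<rho> = y ^ size_of \<nu> * y ^ (size_of \<rho> - size_of \<nu>)"
      by (metis power_add)
    then show ?thesis by (simp add: power_mult_distrib mult_ac)
  qed (simp add: tails_gf_fin_supp)
  have "fps_Sum UNIV (\<lambda>\<rho>. y ^ size_of \<rho> * (?X ^ size_of \<rho> * tails_gf r \<rho>) * tails_gf (Suc c) \<rho>)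
    = fps_Sum UNIV (\<lambda>\<rho>. fps_Sum {\<nu>. interlace \<nu> \<rho>} (\<lambda>\<nu>. ?w \<rho> \<nu>))"
    by (simp only: tails_gf.simps fps_Sum_mult_left) (intro fps_Sum_cong refl, use w in auto)
  \<comment> \<open>Interchanging the sums makes \<nu> the new centre, with \<rho> one step above
    it.\<close>
  also have "\<dots> = fps_Sum UNIV (\<lambda>\<nu>. fps_Sum {\<rho>. interlace \<nu> \<rho>} (\<lambda>\<rho>. ?w \<rho> \<nu>))"
    unfolding fps_Sum_Sigma
    by (rule fps_Sum_reindex[where g = prod.swap and h = prod.swap]) auto
  also have "\<dots> = fps_Sum UNIV (\<lambda>\<nu>. (?X * y) ^ size_of \<nu> * tails_gf c \<nu> *
     ((\<Prod>i<r. geo (?X ^ Suc i * y)) * (?X ^ size_of \<nu> * tails_gf r \<nu>)))"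
  proof (intro fps_Sum_cong refl)
    fix \<nu>
    show "fps_Sum {\<rho>. interlace \<nu> \<rho>} (\<lambda>\<rho>. ?w \<rho> \<nu>) = (?X * y) ^ size_of \<nu> * tails_gf c \<nu> *
     ((\<Prod>i<r. geo (?X ^ Suc i * y)) * (?X ^ size_of \<nu> * tails_gf r \<nu>))"
      \<comment> \<open>For infinite support both sides contain the zero factor
        \<open>tails_gf c \<nu>\<close>.\<close>
      by (cases "fin_supp \<nu>")
        (simp_all only: fps_Sum_mult_left[symmetric] push_tails_gf, simp add: tails_gf_fin_supp)
  qed
  also have "\<dots> = (\<Prod>i<r. geo (?X ^ Suc i * y)) *
     fps_Sum UNIV (\<lambda>\<nu>. (?X * y) ^ size_of \<nu> * (?X ^ size_of \<nu> * tails_gf r \<nu>) * tails_gf c \<nu>)"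
    by (simp add: fps_Sum_mult_left mult_ac)
  also have "\<dots> = (\<Prod>i<r. geo (?X ^ Suc i * y)) * (\<Prod>j<c. \<Prod>i<r. geo (?X ^ Suc (i + j) * (?X * y)))"
    by (simp only: Suc.IH)
  also have "\<dots> = (\<Prod>j<Suc c. \<Prod>i<r. geo (?X ^ Suc (i + j) * y))"
    by (subst prod.lessThan_Suc_shift) (simp add: mult_ac)
  finally show ?case .
qed

subsection \<open>From diagonals to arrays\<close>

text \<open>Padding by the zero partition makes all chains functions on \<open>nat\<close>, so that
  prepending a partition is just \<open>case_nat\<close>.\<close>

definition chains :: "nat \<Rightarrow> (nat \<Rightarrow> nat) \<Rightarrow> (nat \<Rightarrow> nat \<Rightarrow> nat) set" where
  "chains c \<rho> = {h. h 0 = \<rho> \<and> (\<forall>d. interlace (h (Suc d)) (h d)) \<and> (\<forall>d\<ge>c. h d = (\<lambda>_. 0))}"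

lemma chains_0: "chains 0 \<rho> = (if \<rho> = (\<lambda>_. 0) then {\<lambda>_ _. 0} else {})"
  by (auto simp: chains_def interlace_zero_iff)

lemma tails_gf_chains:
  "tails_gf c \<rho> = fps_Sum (chains c \<rho>) (\<lambda>h. fps_X ^ (\<Sum>d<c. size_of (h (Suc d))))"
proof (induction c arbitrary: \<rho>)
  case 0
  then show ?case by (simp add: chains_0)
next
  case (Suc c)
  have "tails_gf (Suc c) \<rho> = fps_Sum {\<nu>. interlace \<nu> \<rho>} (\<lambda>\<nu>. fps_Sum (chains c \<nu>)
      (\<lambda>h. fps_X ^ (size_of \<nu> + (\<Sum>d<c. size_of (h (Suc d))))))"
    by (simp add: Suc.IH fps_Sum_mult_left power_add)
  also have "\<dots> = fps_Sum (chains (Suc c) \<rho>) (\<lambda>h. fps_X ^ (\<Sum>d<Suc c. size_of (h (Suc d))))"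
    unfolding fps_Sum_Sigma
  proof (rule fps_Sum_reindex[where g = "\<lambda>(\<nu>, h). case_nat \<rho> h" and h = "\<lambda>h. (h 1, \<lambda>d. h (Suc d))"], goal_cases)
    case (2 x)
    then show ?case
      by (auto simp: chains_def split: nat.split)
  next
    case (3 y)
    then show ?case by (auto simp: chains_def fun_eq_iff split: nat.split)
  next
    case (4 y)
    then show ?case by (auto simp: chains_def)
  next
    case (5 x)
    then show ?case
      by (auto simp: chains_def sum.lessThan_Suc_shift simp del: sum.lessThan_Suc)
  qed (auto simp: chains_def)
  finally show ?case .
qed

definition arrays :: "nat \<Rightarrow> nat \<Rightarrow> (nat \<Rightarrow> nat \<Rightarrow> nat) set" where
  "arrays r c = {a. (\<forall>i j. a (Suc i) j \<le> a i j) \<and> (\<forall>i j. a i (Suc j) \<le> a i j) \<and>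
     (\<forall>i j. r \<le> i \<or> c \<le> j \<longrightarrow> a i j = 0)}"

lemma arrays_antimono:
  assumes "a \<in> arrays r c" "i \<le> i'" "j \<le> j'"
  shows "a i' j' \<le> a i j"
proof -
  have "a i' j' \<le> a i j'"
    using lift_Suc_antimono_le[of "\<lambda>i. a i j'"] assms by (auto simp: arrays_def)
  also have "\<dots> \<le> a i j"
    using lift_Suc_antimono_le[of "a i"] assms by (auto simp: arrays_def)
  finally show ?thesis .
qed

text \<open>The strictly lower triangle is cut into its subdiagonals, with
  \<open>d = i - j - 1\<close>.\<close>

lemma sum_below_diagonal:
  fixes a :: "nat \<Rightarrow> nat \<Rightarrow> nat"
  assumes "\<And>i j. N \<le> i \<or> N \<le> j \<Longrightarrow> a i j = 0" "\<And>i j. r \<le> i \<Longrightarrow> a i j = 0"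
  shows "(\<Sum>(i, j) | i < N \<and> j < i. a i j) = (\<Sum>d<r. size_of (\<lambda>k. a (Suc d + k) k))"
proof -
  have "(\<Sum>d<r. size_of (\<lambda>k. a (Suc d + k) k)) = (\<Sum>d<r. \<Sum>k<N. a (Suc d + k) k)"
    using assms by (intro sum.cong refl size_of_eq) simp
  also have "\<dots> = (\<Sum>(d, k) \<in> {..<r} \<times> {..<N}. a (Suc d + k) k)"
    by (simp add: sum.cartesian_product)
  also have "\<dots> = (\<Sum>(i, j) | i < N \<and> j < i. a i j)"
  \<comment> \<open>Entries without a partner are zero: \<open>S'\<close> holds positions whose row
    is at least \<open>N\<close>, and \<open>T'\<close> positions on subdiagonals with
    \<open>d \<ge> r\<close>, whose row is at least \<open>r\<close>.\<close>
  proof (rule sum.reindex_bij_witness_not_neutral[where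
        i = "\<lambda>(i, j). (i - Suc j, j)" and j = "\<lambda>(d, k). (Suc d + k, k)" and
        S' = "{p \<in> {..<r} \<times> {..<N}. Suc (fst p + snd p) \<ge> N}" and
        T' = "{p. fst p < N \<and> snd p < fst p \<and> fst p \<ge> Suc (r + snd p)}"], goal_cases)
    case 2
    have "{p. fst p < N \<and> snd p < fst p \<and> fst p \<ge> Suc (r + snd p)} \<subseteq> {..<N} \<times> {..<N}"
      by auto
    then show ?case by (rule finite_subset) auto
  qed (use assms in auto)
  finally show ?thesis by simp
qed

lemma arrays_sum_diagonals:
  assumes "a \<in> arrays r c"
  shows "(\<Sum>i<r. \<Sum>j<c. a i j) = size_of (\<lambda>k. a k k) +
     (\<Sum>d<r. size_of (\<lambda>k. a (Suc d + k) k)) + (\<Sum>d<c. size_of (\<lambda>k. a k (k + Suc d)))"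
proof -
  \<comment> \<open>A square containing the rectangle, so that transposition exchanges the two
    triangles.\<close>
  define N where "N = r + c"
  have z: "a i j = 0" if "r \<le> i \<or> c \<le> j" for i j
    using assms that by (auto simp: arrays_def)
  then have zN: "a i j = 0" if "N \<le> i \<or> N \<le> j" for i j
    using that by (auto simp: N_def)
  let ?T = "{..<N} \<times> {..<N}" and ?L = "{(i, j). i < N \<and> j < i}" and ?U = "{(i, j). j < N \<and> i < j}"
  let ?E = "(\<lambda>k. (k, k)) ` {..<N}"
  have fin: "finite ?L" "finite ?U"
    by (rule finite_subset[of _ ?T]; auto)+
  have "(\<Sum>i<r. \<Sum>j<c. a i j) = (\<Sum>(i, j)\<in>{..<r} \<times> {..<c}. a i j)"
    by (simp add: sum.cartesian_product)
  also have "\<dots> = (\<Sum>(i, j)\<in>?T. a i j)"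
  proof (rule sum.mono_neutral_left)
    show "\<forall>p\<in>?T - {..<r} \<times> {..<c}. (case p of (i, j) \<Rightarrow> a i j) = 0"
      by (auto intro!: z)
  qed (auto simp: N_def)
  also have "?T = ?E \<union> ?L \<union> ?U"
    by (auto simp: image_iff)
  also have "(\<Sum>(i, j)\<in>?E \<union> ?L \<union> ?U. a i j) = (\<Sum>(i, j)\<in>?E. a i j) + (\<Sum>(i, j)\<in>?L. a i j) + (\<Sum>(i, j)\<in>?U. a i j)"
    using fin by (subst sum.union_disjoint; (subst sum.union_disjoint)?) auto
  also have "(\<Sum>(i, j)\<in>?E. a i j) = size_of (\<lambda>k. a k k)"
    using size_of_eq[of N "\<lambda>k. a k k"] zN by (simp add: sum.reindex inj_on_def)
  also have "(\<Sum>(i, j)\<in>?L. a i j) = (\<Sum>d<r. size_of (\<lambda>k. a (Suc d + k) k))"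
    by (rule sum_below_diagonal) (auto simp: z zN)
  also have "(\<Sum>(i, j)\<in>?U. a i j) = (\<Sum>(i, j)\<in>?L. a j i)"
    by (rule sum.reindex_bij_witness[of _ prod.swap prod.swap]) auto
  also have "\<dots> = (\<Sum>d<c. size_of (\<lambda>k. a k (Suc d + k)))"
    by (rule sum_below_diagonal) (auto simp: z zN)
  finally show ?thesis
    by (simp add: add.commute)
qed

text \<open>An array corresponds to its main diagonal with two chains, one of diagonals going down
  and one going right. The inequalities between neighbouring entries are exactly the interlacing of
  neighbouring diagonals.\<close>

lemma arrays_gf:
  "fps_Sum (arrays r c) (\<lambda>a. fps_X ^ (\<Sum>i<r. \<Sum>j<c. a i j)) = (\<Prod>j<c. \<Prod>i<r. geo (fps_X ^ Suc (i + j)))"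
proof -
  let ?w = "\<lambda>(\<rho>, g, h). fps_X ^ (size_of \<rho> + (\<Sum>d<r. size_of (g (Suc d))) + (\<Sum>d<c. size_of (h (Suc d))))"
  let ?f = "\<lambda>a. (\<lambda>k. a k k, \<lambda>d k. a (d + k) k, \<lambda>d k. a k (k + d))"
  let ?b = "\<lambda>(\<rho>, g, h) i j. if j \<le> i then g (i - j) j else h (j - i) i"
  let ?S = "SIGMA \<rho>:UNIV. SIGMA g:chains r \<rho>. chains c \<rho>"
  have "fps_Sum (arrays r c) (\<lambda>a. fps_X ^ (\<Sum>i<r. \<Sum>j<c. a i j)) = fps_Sum ?S ?w"
  proof (rule fps_Sum_reindex[where g = ?f and h = ?b])
    fix a assume a: "a \<in> arrays r c"
    show "?b (?f a) = a"
      by (auto simp: fun_eq_iff)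
    show "?f a \<in> ?S"
      using a by (auto simp: arrays_def chains_def interlace_def fun_eq_iff)
    show "fps_X ^ (\<Sum>i<r. \<Sum>j<c. a i j) = ?w (?f a)"
      by (simp add: arrays_sum_diagonals[OF a])
  next
    fix p assume p: "p \<in> ?S"
    obtain \<rho> g h where p_eq: "p = (\<rho>, g, h)" by (metis prod_cases3)
    define a where "a = ?b p"
    have a_lower: "a i j = g (i - j) j" if "j \<le> i" for i j
      using that by (simp add: a_def p_eq)
    \<comment> \<open>On the diagonal this agrees with \<open>a_lower\<close> since both chains
      start at \<rho>.\<close>
    have a_upper: "a i j = h (j - i) i" if "i \<le> j" for i j
      using that p by (auto simp: a_def p_eq chains_def)
    have g: "g (Suc d) k \<le> g d k" "g d (Suc k) \<le> g (Suc d) k"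
      and h: "h (Suc d) k \<le> h d k" "h d (Suc k) \<le> h (Suc d) k" for d k
      using p by (auto simp: p_eq chains_def interlace_def)
    have mono1: "a (Suc i) j \<le> a i j" for i j
    proof (cases "j \<le> i")
      case True
      then show ?thesis using g(1)[of "i - j" j] by (simp add: a_lower Suc_diff_le)
    next
      case False
      then show ?thesis using h(2)[of "j - Suc i" i] by (simp add: a_upper flip: Suc_diff_le)
    qed
    have mono2: "a i (Suc j) \<le> a i j" for i j
    proof (cases "i \<le> j")
      case True
      then show ?thesis using h(1)[of "j - i" i] by (simp add: a_upper Suc_diff_le)
    next
      case False
      then show ?thesis using g(2)[of "i - Suc j" j] by (simp add: a_lower flip: Suc_diff_le)
    qed
    \<comment> \<open>For \<open>j > 0\<close> the diagonal through \<open>(i, j)\<close> need not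
      be a vanishing one. In column 0 it is, and monotonicity along the row does the rest.\<close>
    have zero1: "a i j = 0" if "r \<le> i" for i j
    proof -
      have "a i j \<le> a i 0"
        using lift_Suc_antimono_le[of "a i" 0 j] mono2 by simp
      also have "a i 0 = 0"
        using that p by (auto simp: a_lower chains_def p_eq)
      finally show ?thesis by simp
    qed
    have zero2: "a i j = 0" if "c \<le> j" for i j
    proof -
      have "a i j \<le> a 0 j"
        using lift_Suc_antimono_le[of "\<lambda>i. a i j" 0 i] mono1 by simp
      also have "a 0 j = 0"
        using that p by (auto simp: a_upper chains_def p_eq)
      finally show ?thesis by simp
    qed
    show "?b p \<in> arrays r c"
      using mono1 mono2 zero1 zero2 by (fold a_def) (auto simp: arrays_def)
    have "(\<lambda>k. a k k) = \<rho>" using p by (auto simp: a_lower p_eq chains_def)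
    moreover have "(\<lambda>d k. a (d + k) k) = g" by (simp add: a_lower)
    moreover have "(\<lambda>d k. a k (k + d)) = h" by (simp add: a_upper)
    ultimately have "?f a = p"
      by (simp add: p_eq)
    then show "?f (?b p) = p"
      by (simp only: a_def)
  qed
  also have "\<dots> = fps_Sum UNIV (\<lambda>\<rho>. fps_Sum (chains r \<rho>) (\<lambda>g. fps_Sum (chains c \<rho>)
      (\<lambda>h. fps_X ^ size_of \<rho> * fps_X ^ (\<Sum>d<r. size_of (g (Suc d))) * fps_X ^ (\<Sum>d<c. size_of (h (Suc d))))))"
    unfolding fps_Sum_Sigma by (simp add: case_prod_unfold power_add)
  also have "\<dots> = fps_Sum UNIV (\<lambda>\<rho>. fps_X ^ size_of \<rho> * tails_gf r \<rho> * tails_gf c \<rho>)"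
    by (simp only: tails_gf_chains fps_Sum_mult_left[symmetric] fps_Sum_mult_right[symmetric])
  also have "\<dots> = (\<Prod>j<c. \<Prod>i<r. geo (fps_X ^ Suc (i + j)))"
    using cauchy_tails_gf[of 1 r c] by simp
  finally show ?thesis .
qed

text \<open>Indices move from \<open>1..n\<close> to \<open>0..n-1\<close>, and the value
  \<open>undefined\<close> outside the square becomes 0. The hypothesis lets \<open>r\<close> rows
  fit into the square.\<close>

lemma pp_eq_card_arrays:
  assumes "r \<le> n"
  shows "pp r n = card {a \<in> arrays r n. (\<Sum>i<r. \<Sum>j<n. a i j) = n}"
proof -
  let ?I = "{1..n} \<times> {1..n}"
  let ?P = "{a \<in> plane_partitions n. \<forall>i\<in>{1..n}. \<forall>j\<in>{1..n}. i > r \<longrightarrow> a (i, j) = 0}"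
  let ?f = "\<lambda>a. restrict (\<lambda>(i, j). a (i - 1) (j - 1)) ?I"
  let ?g = "\<lambda>b i j. if i < n \<and> j < n then b (Suc i, Suc j) else 0"
  have sum_shift: "(\<Sum>(i, j)\<in>?I. f (i - 1) (j - 1)) = (\<Sum>i<r. \<Sum>j<n. f i j)"
    if "\<And>i j. i \<ge> r \<Longrightarrow> i < n \<Longrightarrow> j < n \<Longrightarrow> f i j = 0" for f :: "nat \<Rightarrow> nat \<Rightarrow> nat"
  proof -
    have "(\<Sum>(i, j)\<in>?I. f (i - 1) (j - 1)) = (\<Sum>(i, j)\<in>{..<n} \<times> {..<n}. f i j)"
      by (rule sum.reindex_bij_witness[of _ "\<lambda>(i, j). (Suc i, Suc j)" "\<lambda>(i, j). (i - 1, j - 1)"]) auto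
    also have "\<dots> = (\<Sum>(i, j)\<in>{..<r} \<times> {..<n}. f i j)"
    proof (rule sum.mono_neutral_right)
      show "\<forall>p\<in>{..<n} \<times> {..<n} - {..<r} \<times> {..<n}. (case p of (i, j) \<Rightarrow> f i j) = 0"
        using that by (auto, metis less_irrefl not_le)
    qed (use assms in auto)
    finally show ?thesis by (simp add: sum.cartesian_product)
  qed
  have "bij_betw ?f {a \<in> arrays r n. (\<Sum>i<r. \<Sum>j<n. a i j) = n} ?P"
  proof (rule bij_betw_byWitness[where f' = ?g])
    show "\<forall>a\<in>{a \<in> arrays r n. (\<Sum>i<r. \<Sum>j<n. a i j) = n}. ?g (?f a) = a"
      using assms by (auto simp: arrays_def fun_eq_iff)
    show "\<forall>b\<in>?P. ?f (?g b) = b"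
    proof
      fix b assume "b \<in> ?P"
      then have ext: "b \<in> ?I \<rightarrow>\<^sub>E UNIV" by (simp add: plane_partitions_def)
      show "?f (?g b) = b"
      proof
        fix p
        show "?f (?g b) p = b p"
          using PiE_arb[OF ext, of p] by (cases p) (auto simp: restrict_def)
      qed
    qed
    show "?f ` {a \<in> arrays r n. (\<Sum>i<r. \<Sum>j<n. a i j) = n} \<subseteq> ?P"
    proof (rule image_subsetI)
      fix a assume "a \<in> {a \<in> arrays r n. (\<Sum>i<r. \<Sum>j<n. a i j) = n}"
      then have a: "a \<in> arrays r n" and n: "(\<Sum>i<r. \<Sum>j<n. a i j) = n"
        by auto
      have "(\<Sum>p\<in>?I. ?f a p) = (\<Sum>(i, j)\<in>?I. a (i - 1) (j - 1))"
        by (rule sum.cong) auto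
      also have "\<dots> = (\<Sum>i<r. \<Sum>j<n. a i j)"
        using a by (intro sum_shift) (auto simp: arrays_def)
      finally have "?f a \<in> plane_partitions n"
        using n arrays_antimono[OF a] by (auto simp: plane_partitions_def)
      moreover have "?f a (i, j) = 0" if "i \<in> {1..n}" "j \<in> {1..n}" "i > r" for i j
        using a that by (auto simp: arrays_def)
      ultimately show "?f a \<in> ?P" by blast
    qed
    show "?g ` ?P \<subseteq> {a \<in> arrays r n. (\<Sum>i<r. \<Sum>j<n. a i j) = n}"
    proof (rule image_subsetI)
      fix b assume "b \<in> ?P"
      then have b: "b \<in> plane_partitions n"
        and z: "\<forall>i\<in>{1..n}. \<forall>j\<in>{1..n}. i > r \<longrightarrow> b (i, j) = 0"
        by auto
      have anti: "b (i', j') \<le> b (i, j)" if "1 \<le> i" "1 \<le> j" "i \<le> i'" "j \<le> j'" "i' \<le> n" "j' \<le> n" for i j i' j'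
        using b that by (auto simp: plane_partitions_def)
      have arr: "?g b \<in> arrays r n"
        using z by (auto simp: arrays_def intro!: anti)
      have "(\<Sum>i<r. \<Sum>j<n. ?g b i j) = (\<Sum>(i, j)\<in>?I. ?g b (i - 1) (j - 1))"
        using z by (intro sum_shift[symmetric]) auto
      also have "\<dots> = (\<Sum>p\<in>?I. b p)"
        by (rule sum.cong) auto
      also have "\<dots> = n" using b by (simp add: plane_partitions_def)
      finally have "(\<Sum>i<r. \<Sum>j<n. ?g b i j) = n" .
      with arr show "?g b \<in> {a \<in> arrays r n. (\<Sum>i<r. \<Sum>j<n. a i j) = n}" by blast
    qed
  qed
  then show ?thesis
    unfolding pp_def by (rule bij_betw_same_card[symmetric])
qed

subsection \<open>Coefficients of the product\<close>

text \<open>The generating function of \<open>g\<close> with \<open>X ^ s\<close> substituted for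
  \<open>X\<close>, for positive \<open>s\<close>.\<close>

definition stretch :: "nat \<Rightarrow> (nat \<Rightarrow> 'a) \<Rightarrow> 'a::comm_semiring_1 fps" where
  "stretch s g = Abs_fps (\<lambda>k. if s dvd k then g (k div s) else 0)"

lemma stretch_mult_nth:
  assumes "s > 0"
  shows "(stretch s g * F) $ n = (\<Sum>u\<le>n div s. g u * F $ (n - s * u))"
proof -
  have "(stretch s g * F) $ n = (\<Sum>i=0..n. if s dvd i then g (i div s) * F $ (n - i) else 0)"
    by (auto simp: fps_mult_nth stretch_def intro!: sum.cong)
  also have "\<dots> = (\<Sum>i\<in>{i \<in> {0..n}. s dvd i}. g (i div s) * F $ (n - i))"
    by (subst sum.inter_filter) auto
  also have "\<dots> = (\<Sum>u\<le>n div s. g u * F $ (n - s * u))"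
    using assms
    by (intro sum.reindex_bij_witness[of _ "\<lambda>u. s * u" "\<lambda>i. i div s"])
      (auto simp: less_eq_div_iff_mult_less_eq mult.commute div_le_mono)
  finally show ?thesis .
qed

lemma geo_X_power:
  assumes "s > 0"
  shows "geo (fps_X ^ s) = stretch s (\<lambda>_. 1)"
proof -
  have "geo (fps_X ^ s) $ k = (if s dvd k then 1 else 0)" for k
  proof -
    have "{a. s * a = k} = (if s dvd k then {k div s} else {})"
      using assms by auto
    then show ?thesis
      by (simp add: geo_def fps_Sum_X_power_nth flip: power_mult)
  qed
  then show ?thesis by (simp add: fps_eq_iff stretch_def)
qed

text \<open>The negative binomial series in \<open>X ^ s\<close>; the induction step is a
  convolution with the constant sequence 1.\<close>

lemma stretch_one_power:
  assumes "s > 0"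
  shows "stretch s (\<lambda>_. 1) ^ m = stretch s (\<lambda>k. of_nat ((k + m - 1) choose k))"
proof (induction m)
  case 0
  \<comment> \<open>Truncated subtraction fits here: \<open>0 choose 0\<close> is 1, and
    \<open>(k - 1) choose k\<close> is 0 for positive \<open>k\<close>.\<close>
  show ?case using assms by (auto simp: fps_eq_iff stretch_def binomial_eq_0 elim!: dvdE)
next
  case (Suc m)
  have "(stretch s (\<lambda>_. 1) * stretch s (\<lambda>k. of_nat ((k + m - 1) choose k))) $ n
      = (stretch s (\<lambda>k. of_nat ((k + Suc m - 1) choose k)) :: 'a fps) $ n" for n
  proof (cases "s dvd n")
    case True
    then obtain t where n: "n = s * t" by blast
    have "(stretch s (\<lambda>_. 1) * stretch s (\<lambda>k. of_nat ((k + m - 1) choose k))) $ n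
      = (\<Sum>u\<le>t. of_nat ((t - u + m - 1) choose (t - u)) :: 'a)"
      unfolding n stretch_mult_nth[OF assms]
    proof (rule sum.cong)
      fix u
      have "s * t - s * u = s * (t - u)" by (simp add: diff_mult_distrib2)
      show "1 * stretch s (\<lambda>k. of_nat ((k + m - 1) choose k)) $ (s * t - s * u)
          = (of_nat ((t - u + m - 1) choose (t - u)) :: 'a)"
        unfolding \<open>s * t - s * u = s * (t - u)\<close> using assms by (simp add: stretch_def)
    qed (use assms in simp)
    also have "\<dots> = (\<Sum>u\<le>t. of_nat ((u + m - 1) choose u))"
      by (rule sum.reindex_bij_witness[of _ "\<lambda>u. t - u" "\<lambda>u. t - u"]) auto
    also have "\<dots> = of_nat (\<Sum>u\<le>t. (u + m - 1) choose u)"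
      by simp
    \<comment> \<open>The hockey-stick identity, with \<open>m = 0\<close> treated apart because of
      the truncated subtraction.\<close>
    also have "(\<Sum>u\<le>t. (u + m - 1) choose u) = (t + m) choose t"
    proof (cases m)
      case 0
      have "(\<Sum>u\<le>t. (u - 1) choose u) = (\<Sum>u\<in>{0}. (u - 1) choose u)"
        by (rule sum.mono_neutral_right) auto
      then show ?thesis using 0 by simp
    next
      case (Suc m')
      then show ?thesis using sum_choose_lower[of m' t] by (simp add: add.commute)
    qed
    finally show ?thesis using assms by (simp add: stretch_def n)
  next
    case False
    then have "\<not> s dvd (n - s * u)" if "u \<le> n div s" for u
    proof -
      have "s * u \<le> n"
        using that assms by (simp add: less_eq_div_iff_mult_less_eq mult.commute)
      then show ?thesis
        using False dvd_diffD[of s n "s * u"] by auto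
    qed
    then show ?thesis using False assms
      by (simp add: stretch_mult_nth) (simp add: stretch_def)
  qed
  then show ?case by (simp add: Suc.IH fps_eq_iff)
qed

lemma finite_weighted_PiE:
  fixes S :: "nat set"
  assumes "finite S" "0 \<notin> S"
  shows "finite {l \<in> S \<rightarrow>\<^sub>E UNIV. (\<Sum>s\<in>S. s * l s) = n}"
proof (rule finite_subset)
  show "{l \<in> S \<rightarrow>\<^sub>E UNIV. (\<Sum>s\<in>S. s * l s) = n} \<subseteq> S \<rightarrow>\<^sub>E {..n}"
  proof safe
    fix l :: "nat \<Rightarrow> nat" and s assume "s \<in> S"
    then have "s * l s \<le> (\<Sum>s\<in>S. s * l s)"
      using member_le_sum[of s S "\<lambda>s. s * l s"] assms by simp
    moreover have "l s \<le> s * l s"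
      using \<open>s \<in> S\<close> assms by (cases s) auto
    ultimately show "l s \<le> (\<Sum>s\<in>S. s * l s)" by (rule order_trans[rotated])
  qed auto
  show "finite (S \<rightarrow>\<^sub>E {..n})"
    using assms by (intro finite_PiE) auto
qed

text \<open>Choosing the term of degree \<open>s * l s\<close> from each factor yields the tuples
  \<open>l\<close> of weighted sum \<open>n\<close>.\<close>

lemma prod_stretch_nth:
  assumes "finite S" "0 \<notin> S"
  shows "(\<Prod>s\<in>S. stretch s (g s)) $ n
    = (\<Sum>l | l \<in> S \<rightarrow>\<^sub>E UNIV \<and> (\<Sum>s\<in>S. s * l s) = n. \<Prod>s\<in>S. g s (l s))"
  using assms
proof (induction S arbitrary: n rule: finite_induct)
  case empty
  have "{l. l = (\<lambda>_. undefined) \<and> n = 0} = (if n = 0 then {\<lambda>_. undefined} else {})"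
    by auto
  then show ?case by (simp add: eq_commute[of 0])
next
  case (insert s S)
  let ?L = "\<lambda>S n. {l \<in> S \<rightarrow>\<^sub>E UNIV. (\<Sum>s\<in>S. s * l s) = n} :: (nat \<Rightarrow> nat) set"
  have s: "s > 0" "s \<notin> S" "0 \<notin> S" using insert by auto
  have upd: "(\<Sum>x\<in>S. x * (if x = s then u else l x)) = (\<Sum>x\<in>S. x * l x)"
    "(\<Prod>x\<in>S. g x (if x = s then u else l x)) = (\<Prod>x\<in>S. g x (l x))" for u l
    using s by (auto intro!: sum.cong prod.cong)
  have "(\<Prod>s\<in>insert s S. stretch s (g s)) $ n
      = (\<Sum>u\<le>n div s. g s u * (\<Sum>l\<in>?L S (n - s * u). \<Prod>s\<in>S. g s (l s)))"
    using insert s by (simp add: stretch_mult_nth)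
  also have "\<dots> = (\<Sum>(u, l)\<in>(SIGMA u:{..n div s}. ?L S (n - s * u)). g s u * (\<Prod>s\<in>S. g s (l s)))"
    unfolding sum_distrib_left
    by (rule sum.Sigma) (use insert finite_weighted_PiE s in auto)
  also have "\<dots> = (\<Sum>l\<in>?L (insert s S) n. \<Prod>s\<in>insert s S. g s (l s))"
  \<comment> \<open>Resetting the value at \<open>s\<close> to \<open>undefined\<close> makes the
    remaining tuple extensional on \<open>S\<close>.\<close>
  proof (rule sum.reindex_bij_witness[of _ "\<lambda>l. (l s, l(s := undefined))" "\<lambda>(u, l). l(s := u)"], goal_cases)
    case (1 p)
    then show ?case using s by (auto simp: fun_upd_idem_iff PiE_def extensional_def)
  next
    case (2 p)
    obtain u l where p: "p = (u, l)" by fastforce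
    have "s * u \<le> n"
      using 2 p s by (simp add: less_eq_div_iff_mult_less_eq mult.commute)
    then show ?case using 2 s insert.hyps by (auto simp: p PiE_def extensional_def fun_upd_def upd)
  next
    case (3 l)
    then show ?case by (simp add: fun_upd_triv)
  next
    case (4 l)
    then have n: "s * l s + (\<Sum>s\<in>S. s * l s) = n"
      using insert.hyps by simp
    then have "l s \<le> n div s"
      using s by (simp add: less_eq_div_iff_mult_less_eq mult.commute)
    then show ?case using 4 n s by (auto simp: PiE_def extensional_def fun_upd_def upd)
  next
    case (5 p)
    then show ?case using s insert.hyps by (auto simp: fun_upd_def upd)
  qed
  finally show ?case .
qed

text \<open>Multiplication respects truncation at degree \<open>n\<close>; this serves to discard
  factors that are 1 up to that degree.\<close>

lemma fps_mult_nth_cong: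
  assumes "\<And>k. k \<le> n \<Longrightarrow> F $ k = F' $ k" "\<And>k. k \<le> n \<Longrightarrow> G $ k = G' $ k" "k \<le> n"
  shows "(F * G) $ k = (F' * G') $ k"
  using assms by (auto simp: fps_mult_nth intro!: sum.cong)

lemma fps_prod_nth_one:
  assumes "k \<le> n" "\<And>p k. p \<in> Q \<Longrightarrow> k \<le> n \<Longrightarrow> F p $ k = 1 $ k"
  shows "(\<Prod>p\<in>Q. F p) $ k = 1 $ k"
  using assms
proof (induction Q arbitrary: k rule: infinite_finite_induct)
  case (insert p Q)
  then have "(F p * (\<Prod>p\<in>Q. F p)) $ k = (1 * 1) $ k"
    by (intro fps_mult_nth_cong[of n]) auto
  then show ?case using insert.hyps by simp
qed auto

text \<open>A cell is determined by \<open>i\<close>, subject to \<open>i < s\<close> and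
  \<open>i < r\<close>; then \<open>j = s - Suc i\<close> is below \<open>n\<close> because
  \<open>s \<le> n\<close>.\<close>

lemma card_antidiagonal:
  assumes "s \<in> {1..n}"
  shows "card {(j, i). j < n \<and> i < r \<and> Suc (i + j) = s} = min s r"
proof -
  have "bij_betw (\<lambda>i. (s - Suc i, i)) {..<min s r} {(j, i). j < n \<and> i < r \<and> Suc (i + j) = s}"
    by (rule bij_betw_byWitness[of _ snd]) (use assms in auto)
  then show ?thesis
    using bij_betw_same_card by fastforce
qed

text \<open>Factors with \<open>i + j + 1 > n\<close> do not affect the coefficient; the others are
  collected along the antidiagonals \<open>i + j + 1 = s\<close>, each giving a power of one
  geometric series.\<close>

lemma prod_geo_nth:
  "(\<Prod>j<n. \<Prod>i<r. geo (fps_X ^ Suc (i + j))) $ n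
    = of_nat (\<Sum>l\<in>A n. \<Prod>s=1..n. (l s + min s r - 1) choose l s)"
proof -
  let ?P = "{..<n} \<times> {..<r}"
  let ?w = "\<lambda>p. Suc (snd p + fst p)"
  let ?P1 = "{p \<in> ?P. ?w p \<le> n}" and ?P2 = "{p \<in> ?P. \<not> ?w p \<le> n}"
  let ?G = "\<lambda>p. geo (fps_X ^ ?w p)"
  have "(\<Prod>j<n. \<Prod>i<r. geo (fps_X ^ Suc (i + j))) = (\<Prod>p\<in>?P. ?G p)"
    by (simp add: prod.cartesian_product case_prod_unfold)
  also have "\<dots> = (\<Prod>p\<in>?P1. ?G p) * (\<Prod>p\<in>?P2. ?G p)"
    by (subst prod.union_disjoint[symmetric]) (auto intro!: prod.cong)
  finally have split: "(\<Prod>j<n. \<Prod>i<r. geo (fps_X ^ Suc (i + j))) = (\<Prod>p\<in>?P1. ?G p) * (\<Prod>p\<in>?P2. ?G p)" .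
  have large: "((\<Prod>p\<in>?P1. ?G p) * (\<Prod>p\<in>?P2. ?G p)) $ n = ((\<Prod>p\<in>?P1. ?G p) * 1) $ n"
  proof (rule fps_mult_nth_cong[of n])
    have "?G p $ k = 1 $ k" if "p \<in> ?P2" "k \<le> n" for p k
    proof -
      have "\<not> ?w p dvd k \<or> k = 0"
        using that by (auto dest: dvd_imp_le)
      then show ?thesis
        by (simp only: geo_X_power[OF zero_less_Suc]) (auto simp: stretch_def)
    qed
    then show "(\<Prod>p\<in>?P2. ?G p) $ k = 1 $ k" if "k \<le> n" for k
      using that by (rule fps_prod_nth_one[rotated])
  qed simp_all
  have "(\<Prod>p\<in>?P1. ?G p) = (\<Prod>s=1..n. \<Prod>p\<in>{p \<in> ?P1. ?w p = s}. ?G p)"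
    by (rule prod.group[symmetric]) auto
  also have "\<dots> = (\<Prod>s=1..n. stretch s (\<lambda>k. of_nat ((k + min s r - 1) choose k)))"
  proof (rule prod.cong)
    fix s assume s: "s \<in> {1..n}"
    have "(\<Prod>p\<in>{p \<in> ?P1. ?w p = s}. ?G p) = (\<Prod>p\<in>{(j, i). j < n \<and> i < r \<and> Suc (i + j) = s}. geo (fps_X ^ s))"
      using s by (intro prod.cong) auto
    also have "\<dots> = geo (fps_X ^ s) ^ min s r"
      using card_antidiagonal[OF s] by simp
    also have "\<dots> = stretch s (\<lambda>k. of_nat ((k + min s r - 1) choose k))"
      using s by (simp add: geo_X_power stretch_one_power)
    finally show "(\<Prod>p\<in>{p \<in> ?P1. ?w p = s}. ?G p) = stretch s (\<lambda>k. of_nat ((k + min s r - 1) choose k))" .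
  qed simp
  finally show ?thesis
    unfolding split large by (simp add: prod_stretch_nth A_def)
qed

lemma pp_eq_sum:
  assumes "r \<le> n"
  shows "pp r n = (\<Sum>l\<in>A n. \<Prod>s=1..n. (l s + min s r - 1) choose l s)"
proof -
  let ?B = "{a \<in> arrays r n. (\<Sum>i<r. \<Sum>j<n. a i j) = n}"
  have em: "emeasure (count_space (arrays r n)) ?B = of_nat (\<Sum>l\<in>A n. \<Prod>s=1..n. (l s + min s r - 1) choose l s)"
    by (simp only: fps_Sum_X_power_nth[symmetric] arrays_gf prod_geo_nth)
  \<comment> \<open>Finiteness follows from \<open>em\<close>: the count is a natural number in
    \<open>ennreal\<close>, hence not infinite.\<close>
  have "finite ?B"
  proof (rule ccontr)
    assume "infinite ?B"
    then have "emeasure (count_space (arrays r n)) ?B = \<infinity>"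
      by (intro emeasure_count_space_infinite) auto
    then show False using em by (simp only: infinity_ennreal_def ennreal_of_nat_neq_top)
  qed
  then have "emeasure (count_space (arrays r n)) ?B = of_nat (card ?B)"
    by (intro emeasure_count_space_finite) auto
  then show ?thesis
    using em pp_eq_card_arrays[OF assms] by (simp only: of_nat_eq_iff)
qed

section \<open>Collapse of the inner sums\<close>

lemma less_D:
  assumes "n \<ge> 3"
  shows "n < D n"
proof -
  \<comment> \<open>Two coprime divisors give the lower bound \<open>n * (n - 1)\<close>, which
    exceeds \<open>n\<close> from 3 on; for \<open>n = 2\<close> equality holds.\<close>
  have "n dvd D n" "n - 1 dvd D n"
    using assms unfolding D_def by (intro dvd_Lcm; simp)+
  moreover have "coprime n (n - 1)"
    using assms by (intro coprime_diff_one_right_nat) simp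
  ultimately have "n * (n - 1) dvd D n"
    by (rule divides_mult)
  moreover have "D n > 0"
    by (auto simp: D_def intro!: Nat.gr0I)
  ultimately have "n * (n - 1) \<le> D n"
    by (rule dvd_imp_le)
  moreover have "n * 1 < n * (n - 1)"
    using assms by (intro mult_strict_left_mono) auto
  ultimately show ?thesis by linarith
qed

text \<open>Clearing denominators gives \<open>i * d + j * m = l * m < d\<close>, which forces
  \<open>i = 0\<close>.\<close>

lemma index_pairs_eq:
  assumes "m > 0" "m * l < d"
  shows "index_pairs d m l = {(0, l)}"
proof -
  have "i = 0 \<and> j = l" if "of_nat (i * d) / of_nat m + of_nat j = (of_nat l :: rat)" for i j
  proof -
    have "of_nat (i * d + j * m) = (of_nat (l * m) :: rat)"
      using that assms by (simp add: field_simps)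
    then have eq: "i * d + j * m = l * m"
      by (simp only: of_nat_eq_iff)
    have "i = 0"
    proof (rule ccontr)
      assume "i \<noteq> 0"
      then have "d \<le> i * d" by simp
      also have "\<dots> \<le> m * l" using eq by (simp add: mult.commute)
      finally show False using assms by simp
    qed
    then show ?thesis using eq assms by simp
  qed
  then show ?thesis by (auto simp: index_pairs_def)
qed

theorem theorem2p5:
  fixes n r :: nat
  assumes "n > r" and "r \<ge> 2"
  shows "int (pp r n) =
    (\<Sum>l\<in>A n. \<Prod>s=2..n. \<Sum>(i, j)\<in>index_pairs (D n) (min s r) (l s).
       (-1) ^ i * int (min s r choose i) * int ((j + min s r - 1) choose j))"
proof -
  have "(\<Prod>s=2..n. \<Sum>(i, j)\<in>index_pairs (D n) (min s r) (l s).
       (-1) ^ i * int (min s r choose i) * int ((j + min s r - 1) choose j))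
      = int (\<Prod>s=1..n. (l s + min s r - 1) choose l s)" if l: "l \<in> A n" for l
  proof -
    have "index_pairs (D n) (min s r) (l s) = {(0, l s)}" if s: "s \<in> {2..n}" for s
    proof (rule index_pairs_eq)
      \<comment> \<open>A single summand of the weighted sum is at most \<open>n\<close>, which is
        below \<open>D n\<close> since \<open>n > r \<ge> 2\<close> gives
        \<open>n \<ge> 3\<close>.\<close>
      have "min s r * l s \<le> s * l s" by simp
      also have "\<dots> \<le> (\<Sum>s\<in>{1..n}. s * l s)"
        using s by (intro member_le_sum) auto
      also have "\<dots> < D n"
        using l assms less_D[of n] by (simp add: A_def)
      finally show "min s r * l s < D n" .
    qed (use s assms in auto)
    then have "(\<Prod>s=2..n. \<Sum>(i, j)\<in>index_pairs (D n) (min s r) (l s).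
       (-1) ^ i * int (min s r choose i) * int ((j + min s r - 1) choose j))
       = int (\<Prod>s=2..n. (l s + min s r - 1) choose l s)"
      by simp
    \<comment> \<open>The factor at \<open>s = 1\<close> is \<open>l 1 choose l 1 = 1\<close>, since
      \<open>min 1 r = 1\<close>.\<close>
    also have "(\<Prod>s=2..n. (l s + min s r - 1) choose l s) = (\<Prod>s=1..n. (l s + min s r - 1) choose l s)"
      using assms prod.atLeast_Suc_atMost[of 1 n "\<lambda>s. (l s + min s r - 1) choose l s"]
      by (simp add: numeral_2_eq_2)
    finally show ?thesis .
  qed
  then show ?thesis
    using assms by (simp add: pp_eq_sum)
qed

end
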